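(* Let $G$ be a connected graph such that $\overline{G}$ is connected. Then $\mathrm{m}(G\overline{G})=3$ if $G = C_5$, and $\mathrm{m}(G\overline{G})=2$ otherwise.
   Context: All graphs are finite, simple and undirected; $C_5$ is the cycle on $5$ vertices. The complementary prism $G\overline{G}$ of a graph $G$ is obtained from the disjoint union of $G$ and its complement $\overline{G}$ by adding the edges of the perfect matching joining each vertex $u$ of $G$ to its copy $\overline{u}$ in $\overline{G}$. A path is monophonic if it is an induced (chordless) path. For vertices $u,v$ of a graph $H$, $J_H[u,v]$ is the set of vertices of all monophonic $u,v$-paths in $H$, and for $S\subseteq V(H)$, $J_H[S]=\bigcup_{u,v\in S}J_H[u,v]$. A set $S$ is a monophonic set of $H$ if $J_H[S]=V(H)$; the monophonic number $\mathrm{m}(H)$ is the minimum cardinality of a monophonic set of $H$. *)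

theory Defs
  imports "Graph_Theory.Digraph_Isomorphism" "Graph_Theory.Vertex_Walk"
begin

text \<open>
  A finite simple undirected graph is a \<open>pair_graph\<close>: a finite, loop-free, symmetric digraph whose
  arcs are ordered pairs of vertices, so that each undirected edge is represented by its two
  orientations. The null graph satisfies \<open>pair_graph\<close>, but not \<open>Digraph_Component.connected\<close>.
\<close>

definition complement_graph :: "'a pair_pre_digraph \<Rightarrow> 'a pair_pre_digraph" where
  "complement_graph G =
    \<lparr> pverts = pverts G,
      parcs = {(u, v). u \<in> pverts G \<and> v \<in> pverts G \<and> u \<noteq> v \<and> (u, v) \<notin> parcs G} \<rparr>"

text \<open>\<open>Inl u\<close> is the vertex \<open>u\<close> of \<open>G\<close>, and \<open>Inr u\<close> is its copy in the complement.\<close>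

definition complementary_prism :: "'a pair_pre_digraph \<Rightarrow> ('a + 'a) pair_pre_digraph" where
  "complementary_prism G =
    \<lparr> pverts = Inl ` pverts G \<union> Inr ` pverts (complement_graph G),
      parcs = map_prod Inl Inl ` parcs G
        \<union> map_prod Inr Inr ` parcs (complement_graph G)
        \<union> {(Inl u, Inr u) | u. u \<in> pverts G}
        \<union> {(Inr u, Inl u) | u. u \<in> pverts G} \<rparr>"

text \<open>For \<open>n \<ge> 3\<close> this is the cycle on \<open>n\<close> vertices.\<close>

definition cycle_graph :: "nat \<Rightarrow> nat pair_pre_digraph" where
  "cycle_graph n =
    \<lparr> pverts = {..<n},
      parcs = {(i, j). i < n \<and> j < n \<and> (j = Suc i mod n \<or> i = Suc j mod n)} \<rparr>"

text \<open>
  A path is given by its list of vertices. It is chordless if the only adjacencies of \<open>H\<close> between its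
  vertices are those between consecutive ones. The one-vertex list is the monophonic path from a
  vertex to itself.
\<close>

definition monophonic_path :: "'a pair_pre_digraph \<Rightarrow> 'a \<Rightarrow> 'a list \<Rightarrow> 'a \<Rightarrow> bool" where
  "monophonic_path H u p v \<longleftrightarrow>
    vpath p (with_proj H) \<and> hd p = u \<and> last p = v \<and>
    (\<forall>i < length p. \<forall>j < length p. (p ! i, p ! j) \<in> parcs H \<longrightarrow> j = Suc i \<or> i = Suc j)"

definition monophonic_interval :: "'a pair_pre_digraph \<Rightarrow> 'a \<Rightarrow> 'a \<Rightarrow> 'a set" where
  "monophonic_interval H u v = \<Union> {set p | p. monophonic_path H u p v}"

definition monophonic_closure :: "'a pair_pre_digraph \<Rightarrow> 'a set \<Rightarrow> 'a set" where
  "monophonic_closure H S = (\<Union>u\<in>S. \<Union>v\<in>S. monophonic_interval H u v)"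

definition monophonic_set :: "'a pair_pre_digraph \<Rightarrow> 'a set \<Rightarrow> bool" where
  "monophonic_set H S \<longleftrightarrow> S \<subseteq> pverts H \<and> monophonic_closure H S = pverts H"

text \<open>For finite \<open>H\<close> the minimum exists, since the set of all vertices is a monophonic set.\<close>

definition monophonic_number :: "'a pair_pre_digraph \<Rightarrow> nat" where
  "monophonic_number H = (LEAST k. \<exists>S. monophonic_set H S \<and> card S = k)"

lemma pair_graph_complement_graph:
  assumes "pair_graph G"
  shows "pair_graph (complement_graph G)"
proof -
  interpret pair_graph G by fact
  have "finite (pverts G \<times> pverts G)" by simp
  then have "finite (parcs (complement_graph G))"
    by (rule rev_finite_subset) (auto simp: complement_graph_def)
  moreover have "sym (parcs G)"
    using pair_sym_arcs by (simp add: symmetric_def)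
  ultimately show ?thesis
    by unfold_locales (auto simp: complement_graph_def symmetric_def sym_def)
qed

lemma pair_graph_complementary_prism:
  assumes "pair_graph G"
  shows "pair_graph (complementary_prism G)"
proof -
  interpret G: pair_graph G by fact
  interpret C: pair_graph "complement_graph G"
    using assms by (rule pair_graph_complement_graph)
  have [simp]: "pverts (complement_graph G) = pverts G"
    by (simp add: complement_graph_def)
  have "sym (parcs G)" "sym (parcs (complement_graph G))"
    using G.pair_sym_arcs C.pair_sym_arcs by (simp_all add: symmetric_def)
  then have "symmetric (with_proj (complementary_prism G))"
    by (auto simp: complementary_prism_def symmetric_def intro!: symI dest: symD)
  then show ?thesis
    by unfold_locales
      (auto simp: complementary_prism_def dest: G.in_arcsD1 G.in_arcsD2 C.in_arcsD1 C.in_arcsD2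
        G.pair_no_loops C.pair_no_loops)
qed

lemma pair_graph_cycle_graph:
  assumes "n \<ge> 3"
  shows "pair_graph (cycle_graph n)"
proof -
  have "finite ({..<n} \<times> {..<n})" by simp
  then have "finite (parcs (cycle_graph n))"
    by (rule rev_finite_subset) (auto simp: cycle_graph_def)
  moreover have "Suc i mod n \<noteq> i" for i
    using assms by (cases "Suc i < n"; cases "Suc i = n") (auto, metis mod_less_divisor
      not_less_eq not_less_iff_gr_or_eq less_le_trans zero_less_numeral)
  ultimately show ?thesis
    by unfold_locales (auto simp: cycle_graph_def symmetric_def sym_def, metis+)
qed

lemma monophonic_set_pverts:
  assumes "pair_graph H"
  shows "monophonic_set H (pverts H)"
proof -
  interpret pair_graph H by fact
  have "monophonic_path H u [u] u" if "u \<in> pverts H" for u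
    using that pair_no_loops by (fastforce simp: monophonic_path_def vpath_def vwalk_def)
  then have "u \<in> monophonic_interval H u u" if "u \<in> pverts H" for u
    using that by (force simp: monophonic_interval_def)
  moreover have "monophonic_interval H u v \<subseteq> pverts H" for u v
    by (auto simp: monophonic_interval_def monophonic_path_def vpath_def vwalk_def)
  ultimately show ?thesis
    by (fastforce simp: monophonic_set_def monophonic_closure_def)
qed

end

theory Submission
  imports Defs
begin

text \<open>
  Suppose first that \<open>G\<close> has nonadjacent vertices \<open>u\<close>, \<open>w\<close> without a common neighbour. Fix \<open>u\<close> and
  choose \<open>w\<close> so that the component \<open>K\<close> of \<open>u\<close> in \<open>G - N[w]\<close> is as large as possible. By maximality
  every vertex outside \<open>K \<union> N[w]\<close> is adjacent to each vertex of \<open>N(w)\<close> with a neighbour in \<open>K\<close>, and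
  it follows that \<open>{u, w}\<close> is a monophonic set of the prism. The same applies to the complement.

  Otherwise \<open>G\<close> and its complement have diameter at most two. If \<open>u\<close>, \<open>w\<close> are adjacent and \<open>w\<close> is
  never the only common neighbour of \<open>u\<close> and a nonneighbour of \<open>u\<close>, then \<open>u\<close> and the copy of \<open>w\<close> form
  a monophonic set. If no such arc exists in \<open>G\<close> or in its complement, then for each \<open>u\<close> the
  neighbours inject into the nonneighbours and conversely; the resulting bijections force all
  degrees to be two, so \<open>G\<close> is the five-cycle.

  The prism of the five-cycle is the Petersen graph: cubic, of girth five and diameter two, with ten
  vertices. If \<open>c\<close> is the common neighbour of \<open>u\<close> and \<open>w\<close>, the third neighbour of \<open>c\<close> lies on no
  induced path between \<open>u\<close> and \<open>w\<close>, since such a path together with its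
  neighbours would comprise at least eleven vertices. The
  three neighbours of \<open>c\<close> form a monophonic set.
\<close>

section \<open>Induced paths\<close>

text \<open>Each vertex is compared only with later ones, which suffices because the arcs are
  symmetric and loop-free. With this recursion explicit vertex lists are checked by
  simplification.\<close>

fun induced_path :: "'a pair_pre_digraph \<Rightarrow> 'a list \<Rightarrow> bool" where
  "induced_path H [] \<longleftrightarrow> False"
| "induced_path H [x] \<longleftrightarrow> x \<in> pverts H"
| "induced_path H (x # y # zs) \<longleftrightarrow>
    (x, y) \<in> parcs H \<and> x \<notin> set zs \<and> (\<forall>z\<in>set zs. (x, z) \<notin> parcs H) \<and> induced_path H (y # zs)"

lemma pair_graph_arcs_sym:
  assumes "pair_graph H" "(x, y) \<in> parcs H"
  shows "(y, x) \<in> parcs H"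
proof -
  interpret pair_graph H by fact
  show ?thesis using assms(2) arcs_symmetric by blast
qed

lemma pair_graph_arcs_verts:
  assumes "pair_graph H" "(x, y) \<in> parcs H"
  shows "x \<in> pverts H" "y \<in> pverts H" "x \<noteq> y"
proof -
  interpret pair_graph H by fact
  show "x \<in> pverts H" "y \<in> pverts H" "x \<noteq> y"
    using assms(2) in_arcsD1 in_arcsD2 no_loops' by blast+
qed

lemma finite_pverts: "pair_graph H \<Longrightarrow> finite (pverts H)"
  by (auto simp: pair_graph_def pair_digraph_def dest: pair_fin_digraph.pair_finite_verts)

text \<open>Index 0 is split off both quantifiers. Arcs between \<open>x\<close> and
  \<open>y\<close> stay unrestricted because indices 0 and 1 are consecutive.\<close>

lemma chordless_Cons_Cons_iff:
  "(\<forall>i < length (x # y # zs). \<forall>j < length (x # y # zs).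
      ((x # y # zs) ! i, (x # y # zs) ! j) \<in> A \<longrightarrow> j = Suc i \<or> i = Suc j) \<longleftrightarrow>
    (x, x) \<notin> A \<and> (\<forall>z\<in>set zs. (x, z) \<notin> A \<and> (z, x) \<notin> A) \<and>
    (\<forall>i < length (y # zs). \<forall>j < length (y # zs).
      ((y # zs) ! i, (y # zs) ! j) \<in> A \<longrightarrow> j = Suc i \<or> i = Suc j)"
  by (simp only: length_Cons All_less_Suc2 nth_Cons_0 nth_Cons_Suc) (auto simp: all_set_conv_all_nth)

lemma induced_path_iff:
  assumes "pair_graph H"
  shows "induced_path H p \<longleftrightarrow> vpath p (with_proj H) \<and>
    (\<forall>i < length p. \<forall>j < length p. (p ! i, p ! j) \<in> parcs H \<longrightarrow> j = Suc i \<or> i = Suc j)"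
  using assms
proof (induction H p rule: induced_path.induct)
  case (1 H)
  then show ?case by (simp add: vpath_def vwalk_def)
next
  case (2 H x)
  then show ?case by (auto simp: vpath_def vwalk_def dest: pair_graph_arcs_verts(3))
next
  case (3 H x y zs)
  have "(a, x) \<in> parcs H \<longleftrightarrow> (x, a) \<in> parcs H" "(x, x) \<notin> parcs H" for a
    using 3(2) pair_graph_arcs_sym pair_graph_arcs_verts(3) by metis+
  moreover have "vpath (x # y # zs) (with_proj H) \<longleftrightarrow>
      (x, y) \<in> parcs H \<and> x \<notin> set zs \<and> vpath (y # zs) (with_proj H)"
    using 3(2) by (auto simp: vpath_def vwalk_def dest: pair_graph_arcs_verts)
  ultimately show ?case
    unfolding chordless_Cons_Cons_iff induced_path.simps 3(1)[OF 3(2)] by blast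
qed

lemma monophonic_path_iff:
  assumes "pair_graph H"
  shows "monophonic_path H u p v \<longleftrightarrow> induced_path H p \<and> hd p = u \<and> last p = v"
  by (auto simp: monophonic_path_def induced_path_iff[OF assms])

lemma monophonic_intervalI:
  assumes "pair_graph H" "induced_path H p" "hd p = u" "last p = v" "x \<in> set p"
  shows "x \<in> monophonic_interval H u v"
  using assms by (auto simp: monophonic_interval_def monophonic_path_iff)

lemma monophonic_intervalE:
  assumes "pair_graph H" "x \<in> monophonic_interval H u v"
  obtains p where "induced_path H p" "hd p = u" "last p = v" "x \<in> set p"
  using assms by (auto simp: monophonic_interval_def monophonic_path_iff)

lemma induced_path_subset: "induced_path H p \<Longrightarrow> pair_graph H \<Longrightarrow> set p \<subseteq> pverts H"
  by (induction H p rule: induced_path.induct) (auto dest: pair_graph_arcs_verts)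

lemma induced_path_distinct: "induced_path H p \<Longrightarrow> pair_graph H \<Longrightarrow> distinct p"
  by (induction H p rule: induced_path.induct) (auto dest: pair_graph_arcs_verts)

lemma induced_path_appendD: "induced_path H (p @ q) \<Longrightarrow> q \<noteq> [] \<Longrightarrow> induced_path H q"
proof (induction p)
  case (Cons x p)
  then show ?case by (cases "p @ q") auto
qed simp

lemma induced_path_arc:
  "induced_path H p \<Longrightarrow> Suc i < length p \<Longrightarrow> (p ! i, p ! Suc i) \<in> parcs H"
  by (induction H p arbitrary: i rule: induced_path.induct) (auto simp: nth_Cons split: nat.split)

text \<open>Attaching \<open>y\<close> to the last of its neighbours on the path keeps the path chordless.\<close>

lemma induced_path_extend:
  assumes H: "pair_graph H" and p: "induced_path H p" and xy: "(y, hd p) \<in> parcs H"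
  shows "\<exists>q. induced_path H q \<and> hd q = y \<and> last q = last p \<and> set q \<subseteq> insert y (set p)"
proof (cases "y \<in> set p")
  case True
  then obtain ys zs where p': "p = ys @ y # zs" by (auto dest: split_list)
  then have "induced_path H (y # zs)" using p induced_path_appendD by blast
  then show ?thesis using p' by (intro exI[of _ "y # zs"]) auto
next
  case False
  have "hd p \<in> set p" using p by (cases p) auto
  then have "\<exists>z\<in>set p. (y, z) \<in> parcs H" using xy by blast
  then obtain ys z zs where p': "p = ys @ z # zs" "(y, z) \<in> parcs H"
    and zs: "\<forall>x\<in>set zs. (y, x) \<notin> parcs H"
    using split_list_last_prop[of p "\<lambda>z. (y, z) \<in> parcs H"] by blast
  then have "induced_path H (z # zs)" using p induced_path_appendD by blast
  with False p' zs have "induced_path H (y # z # zs)" by auto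
  then show ?thesis using p' by (intro exI[of _ "y # z # zs"]) auto
qed

text \<open>Each step of the walk extends the path at its front, so the path runs backwards from
  \<open>x\<close> to \<open>u\<close> and never leaves \<open>S\<close>.\<close>

lemma induced_path_rtrancl:
  assumes H: "pair_graph H" and S: "u \<in> S" "S \<subseteq> pverts H" and r: "(u, x) \<in> (parcs H \<inter> S \<times> S)\<^sup>*"
  shows "\<exists>p. induced_path H p \<and> hd p = x \<and> last p = u \<and> set p \<subseteq> S"
  using r
proof (induction rule: rtrancl_induct)
  case base
  show ?case using S by (intro exI[of _ "[u]"]) auto
next
  case (step y z)
  then obtain p where p: "induced_path H p" "hd p = y" "last p = u" "set p \<subseteq> S" by auto
  have "(z, hd p) \<in> parcs H" using step p pair_graph_arcs_sym[OF H] by auto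
  from induced_path_extend[OF H p(1) this] obtain q
    where "induced_path H q" "hd q = z" "last q = last p" "set q \<subseteq> insert z (set p)" by blast
  then show ?case using p step by (intro exI[of _ q]) auto
qed

lemma monophonic_interval_subset:
  assumes H: "pair_graph H"
  shows "monophonic_interval H u v \<subseteq> pverts H"
proof
  fix x assume "x \<in> monophonic_interval H u v"
  then obtain p where "induced_path H p" "x \<in> set p"
    using H by (auto elim: monophonic_intervalE)
  then show "x \<in> pverts H" using H induced_path_subset by blast
qed

section \<open>Monophonic numbers\<close>

lemma monophonic_number_eqI:
  assumes "monophonic_set H S" "card S = k" "\<And>S. monophonic_set H S \<Longrightarrow> k \<le> card S"
  shows "monophonic_number H = k"
  unfolding monophonic_number_def using assms by (intro Least_equality) auto

lemma monophonic_interval_self: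
  assumes "pair_graph H"
  shows "monophonic_interval H u u \<subseteq> {u}"
proof
  fix x assume "x \<in> monophonic_interval H u u"
  then obtain p where p: "induced_path H p" "hd p = u" "last p = u" "x \<in> set p"
    using assms by (auto elim: monophonic_intervalE)
  then have "distinct p" using assms induced_path_distinct by blast
  then show "x \<in> {u}" using p by (cases p) (auto split: if_splits)
qed

text \<open>Induced paths have distinct vertices, so a single vertex generates at most itself and
  the empty set generates nothing.\<close>

lemma two_le_card_monophonic_set:
  assumes H: "pair_graph H" and ab: "a \<in> pverts H" "b \<in> pverts H" "a \<noteq> b" and S: "monophonic_set H S"
  shows "2 \<le> card S"
proof (rule ccontr)
  assume "\<not> 2 \<le> card S"
  moreover have "finite S"
    using S finite_pverts[OF H] by (auto simp: monophonic_set_def dest: finite_subset)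
  ultimately have "S = {} \<or> (\<exists>u. S = {u})"
    by (metis One_nat_def card_1_singleton_iff card_eq_0_iff less_2_cases not_le)
  then have "\<exists>u. pverts H \<subseteq> {u}"
  proof
    assume "S = {}"
    then show ?thesis using S by (simp add: monophonic_set_def monophonic_closure_def)
  next
    assume "\<exists>u. S = {u}"
    then obtain u where "S = {u}" ..
    then have "pverts H = monophonic_interval H u u"
      using S by (simp add: monophonic_set_def monophonic_closure_def)
    then show ?thesis using monophonic_interval_self[OF H] by auto
  qed
  then show False using ab by blast
qed

lemma monophonic_set_pairI:
  assumes H: "pair_graph H" and "u \<in> pverts H" "v \<in> pverts H"
    and "\<And>x. x \<in> pverts H \<Longrightarrow> x \<in> monophonic_interval H u v"
  shows "monophonic_set H {u, v}"
  using assms(2-) monophonic_interval_subset[OF H]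
  by (auto simp: monophonic_set_def monophonic_closure_def subset_iff)

lemma induced_path_map:
  assumes "induced_path H p" and "inj f" "\<And>x. x \<in> pverts H \<Longrightarrow> f x \<in> pverts H'"
    and "\<And>x y. (f x, f y) \<in> parcs H' \<longleftrightarrow> (x, y) \<in> parcs H"
  shows "induced_path H' (map f p)"
  using assms by (induction H p rule: induced_path.induct) (auto simp: inj_image_mem_iff)

lemma monophonic_set_image:
  assumes H: "pair_graph H" "pair_graph H'" and f: "inj f" "pverts H' = f ` pverts H"
    and arcs: "\<And>x y. (f x, f y) \<in> parcs H' \<longleftrightarrow> (x, y) \<in> parcs H"
    and S: "monophonic_set H S"
  shows "monophonic_set H' (f ` S)"
proof -
  have "f x \<in> monophonic_interval H' (f u) (f v)" if x: "x \<in> monophonic_interval H u v" for x u v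
  proof -
    from x obtain p where p: "induced_path H p" "hd p = u" "last p = v" "x \<in> set p"
      using H by (auto elim: monophonic_intervalE)
    then have "induced_path H' (map f p)" using f arcs by (intro induced_path_map) auto
    moreover have "p \<noteq> []" using p by auto
    ultimately show ?thesis using p by (intro monophonic_intervalI[OF H(2)]) (auto simp: hd_map last_map)
  qed
  then have "pverts H' \<subseteq> monophonic_closure H' (f ` S)"
    using S f by (fastforce simp: monophonic_set_def monophonic_closure_def)
  moreover have "monophonic_closure H' (f ` S) \<subseteq> pverts H'"
    using monophonic_interval_subset[OF H(2)] by (auto simp: monophonic_closure_def)
  ultimately show ?thesis using S f by (auto simp: monophonic_set_def)
qed

section \<open>Complementary prisms\<close>

lemma complement_graph_simps [simp]:
  "pverts (complement_graph G) = pverts G"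
  "(u, v) \<in> parcs (complement_graph G) \<longleftrightarrow>
    u \<in> pverts G \<and> v \<in> pverts G \<and> u \<noteq> v \<and> (u, v) \<notin> parcs G"
  by (auto simp: complement_graph_def)

lemma complement_complement_graph:
  assumes "pair_graph G"
  shows "complement_graph (complement_graph G) = G"
proof -
  have "parcs (complement_graph (complement_graph G)) = parcs G"
    using pair_graph_arcs_verts(1,2)[OF assms] pair_graph_arcs_verts(3)[OF assms, of x x for x]
    by (auto simp: set_eq_iff)
  then show ?thesis by (simp add: complement_graph_def)
qed

lemma pverts_complementary_prism:
  "pverts (complementary_prism G) = Inl ` pverts G \<union> Inr ` pverts G"
  by (simp add: complementary_prism_def)

lemma complementary_prism_simps [simp]:
  "Inl u \<in> pverts (complementary_prism G) \<longleftrightarrow> u \<in> pverts G"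
  "Inr u \<in> pverts (complementary_prism G) \<longleftrightarrow> u \<in> pverts G"
  "(Inl u, Inl v) \<in> parcs (complementary_prism G) \<longleftrightarrow> (u, v) \<in> parcs G"
  "(Inr u, Inr v) \<in> parcs (complementary_prism G) \<longleftrightarrow> (u, v) \<in> parcs (complement_graph G)"
  "(Inl u, Inr v) \<in> parcs (complementary_prism G) \<longleftrightarrow> u = v \<and> u \<in> pverts G"
  "(Inr u, Inl v) \<in> parcs (complementary_prism G) \<longleftrightarrow> u = v \<and> u \<in> pverts G"
  by (auto simp: complementary_prism_def image_iff Bex_def)

text \<open>Exchanging the two copies is an isomorphism between the prisms of a graph and of its
  complement. Results on \<open>G\<close> thereby transfer to
  \<open>complement_graph G\<close>.\<close>

lemma monophonic_set_swap:
  assumes G: "pair_graph G" and S: "monophonic_set (complementary_prism (complement_graph G)) S"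
  shows "monophonic_set (complementary_prism G) (case_sum Inr Inl ` S)"
proof (rule monophonic_set_image[OF _ _ _ _ _ S])
  show "pair_graph (complementary_prism (complement_graph G))" "pair_graph (complementary_prism G)"
    using G by (simp_all add: pair_graph_complementary_prism pair_graph_complement_graph)
  show "inj (case_sum Inr Inl :: 'a + 'a \<Rightarrow> _)"
    by (auto simp: inj_def split: sum.splits)
  show "pverts (complementary_prism G) =
    case_sum Inr Inl ` pverts (complementary_prism (complement_graph G))"
    by (simp add: pverts_complementary_prism image_Un image_image Un_commute)
  show "(case_sum Inr Inl x, case_sum Inr Inl y) \<in> parcs (complementary_prism G) \<longleftrightarrow>
    (x, y) \<in> parcs (complementary_prism (complement_graph G))" for x y
    using pair_graph_arcs_verts(1,2)[OF G] pair_graph_arcs_verts(3)[OF G, of a a for a]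
    by (auto split: sum.splits)
qed

lemma ex_monophonic_pair_swap:
  assumes G: "pair_graph G"
    and "\<exists>S. monophonic_set (complementary_prism (complement_graph G)) S \<and> card S = 2"
  shows "\<exists>S. monophonic_set (complementary_prism G) S \<and> card S = 2"
proof -
  obtain S where S: "monophonic_set (complementary_prism (complement_graph G)) S" "card S = 2"
    using assms by blast
  have "inj_on (case_sum Inr Inl) S"
    by (auto simp: inj_on_def split: sum.splits)
  with monophonic_set_swap[OF G S(1)] S(2) show ?thesis by (metis card_image)
qed

section \<open>Diameter at least three\<close>

text \<open>A walk from \<open>u\<close> to \<open>w\<close> exists by connectedness and must leave
  \<open>S\<close> somewhere.\<close>

lemma connected_leaving_arc:
  assumes G: "pair_graph G" "Digraph_Component.connected (with_proj G)"
    and S: "u \<in> S" "S \<subseteq> pverts G" "w \<in> pverts G" "w \<notin> S"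
  obtains c s where "c \<in> S" "s \<notin> S" "(c, s) \<in> parcs G"
proof -
  have "(u, w) \<in> rtrancl_on (pverts G) ((parcs G)\<^sup>s)"
    using G(2) S by (auto simp: connected_conv)
  moreover have "(parcs G)\<^sup>s = parcs G"
    using pair_graph_arcs_sym[OF G(1)] by (auto simp: symcl_def)
  ultimately have "(u, w) \<in> (parcs G)\<^sup>*" by (simp add: rtrancl_on_rtranclI)
  then show thesis
    using S(1,4) that by (induction rule: converse_rtrancl_induct) blast+
qed

lemma monophonic_set_far:
  assumes G: "pair_graph G" "Digraph_Component.connected (with_proj G)"
    and w0: "u \<in> pverts G" "w0 \<in> pverts G" "u \<noteq> w0" "(u, w0) \<notin> parcs G"
      "\<And>t. (u, t) \<in> parcs G \<Longrightarrow> (t, w0) \<notin> parcs G"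
  shows "\<exists>w\<in>pverts G. w \<noteq> u \<and> monophonic_set (complementary_prism G) {Inl w, Inl u}"
proof -
  note sym = pair_graph_arcs_sym[OF G(1)] and vert = pair_graph_arcs_verts[OF G(1)]
  have P: "pair_graph (complementary_prism G)" using G(1) by (rule pair_graph_complementary_prism)
  \<comment> \<open>\<open>far w\<close> puts \<open>w\<close> at distance at least three from
    \<open>u\<close>. \<open>A w\<close> consists of the vertices outside the closed neighbourhood
    of \<open>w\<close>, and for far \<open>w\<close> the set \<open>R w\<close> is the component of
    \<open>u\<close> in the subgraph induced by \<open>A w\<close>.\<close>
  define far where "far w \<longleftrightarrow> w \<in> pverts G \<and> u \<noteq> w \<and> (u, w) \<notin> parcs G \<and>
    (\<forall>t. (u, t) \<in> parcs G \<longrightarrow> (t, w) \<notin> parcs G)" for w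
  define A where "A w = {x \<in> pverts G. x \<noteq> w \<and> (x, w) \<notin> parcs G}" for w
  define R where "R w = {x. (u, x) \<in> (parcs G \<inter> A w \<times> A w)\<^sup>*}" for w
  have uA: "u \<in> A w" if "far w" for w using that w0(1) by (auto simp: far_def A_def)
  have RA: "R w \<subseteq> A w" if "far w" for w
    using uA[OF that] by (auto simp: R_def elim: rtranclE)
  have fin: "finite (pverts G)" using G(1) by (rule finite_pverts)
  have finR: "finite (R w)" if "far w" for w
    using RA[OF that] fin by (auto simp: A_def intro: finite_subset)
  have "far w0" using w0 by (auto simp: far_def)
  have "card (R w) < Suc (card (pverts G))" if "far w" for w
    using RA[OF that] by (intro le_imp_less_Suc card_mono fin) (simp add: A_def subset_iff)
  \<comment> \<open>A far vertex with the largest component exists, since the component sizes are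
    bounded by the number of vertices.\<close>
  then have "\<exists>w. far w \<and> (\<forall>w'. far w' \<longrightarrow> card (R w') \<le> card (R w))"
    using \<open>far w0\<close> by (intro ex_has_greatest_nat) blast+
  then obtain w where w: "far w" and max: "\<And>w'. far w' \<Longrightarrow> card (R w') \<le> card (R w)"
    by blast
  let ?C = "R w"
  have uC: "u \<in> ?C" by (simp add: R_def)
  have CA: "?C \<subseteq> A w" using RA w .
  have R_step: "y \<in> R w'" if "x \<in> R w'" "(x, y) \<in> parcs G" "y \<in> A w'" "far w'" for x y w'
    using that RA[of w'] unfolding R_def by (auto intro: rtrancl_into_rtrancl)
  have wV: "w \<in> pverts G" "u \<noteq> w" "(u, w) \<notin> parcs G" "(w, u) \<notin> parcs G"
    using w sym by (auto simp: far_def)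
  \<comment> \<open>An arc leaving the component must end in a neighbour \<open>s\<close> of
    \<open>w\<close>, for otherwise \<open>s\<close> would belong to the component.\<close>
  obtain c s where cs: "c \<in> ?C" "s \<notin> ?C" "(c, s) \<in> parcs G"
    using connected_leaving_arc[OF G uC _ wV(1)] CA by (auto simp: A_def)
  have sw: "(s, w) \<in> parcs G"
    using R_step[OF cs(1,3) _ w] cs CA vert sym by (auto simp: A_def)
  have su: "(s, u) \<notin> parcs G" "s \<noteq> u" "s \<noteq> w" using w sw sym cs(2) uC vert by (auto simp: far_def)
  \<comment> \<open>Suppose \<open>x\<close> is not adjacent to \<open>s\<close>. No vertex of
    \<open>?C\<close> is adjacent to \<open>x\<close>, and all neighbours of \<open>u\<close> lie in
    \<open>?C\<close>, so \<open>x\<close> is far as well. Then \<open>R x\<close> contains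
    \<open>?C\<close> and also \<open>s\<close>, against the maximality of
    \<open>R w\<close>.\<close>
  have far_complete: "(s, x) \<in> parcs G" if x: "x \<in> pverts G" "x \<notin> ?C" "x \<noteq> w" "(x, w) \<notin> parcs G" for x
  proof (rule ccontr)
    assume sx: "(s, x) \<notin> parcs G"
    have anti: "(y, x) \<notin> parcs G" if "y \<in> ?C" for y
      using R_step[of y w x] that x w by (auto simp: A_def)
    have "far x" unfolding far_def
    proof (intro conjI allI impI)
      show "(t, x) \<notin> parcs G" if "(u, t) \<in> parcs G" for t
      proof -
        have "t \<in> A w" using that w vert by (auto simp: far_def A_def)
        then show ?thesis using R_step[OF uC that _ w] anti by blast
      qed
    qed (use x uC anti in auto)
    have CAx: "?C \<subseteq> A x" using anti CA x(2) by (auto simp: A_def)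
    have sub: "y \<in> R x" if "y \<in> ?C" for y
    proof -
      have "(u, y) \<in> (parcs G \<inter> A w \<times> A w)\<^sup>*" using that by (simp add: R_def)
      then show ?thesis
      proof (induction rule: rtrancl_induct)
        case base then show ?case by (simp add: R_def)
      next
        case (step y z)
        then have "z \<in> ?C" unfolding R_def by (auto intro: rtrancl_into_rtrancl)
        then show ?case using step \<open>far x\<close> CAx R_step[of y x z] by auto
      qed
    qed
    have "s \<noteq> x" using sw x by auto
    then have "s \<in> A x" using sx vert cs by (auto simp: A_def)
    then have "s \<in> R x" using R_step[OF sub[OF cs(1)] cs(3)] \<open>far x\<close> by blast
    then have "?C \<subset> R x" using sub cs(2) by blast
    then have "card ?C < card (R x)" using finR[OF \<open>far x\<close>] by (rule psubset_card_mono[rotated])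
    then show False using max[OF \<open>far x\<close>] by simp
  qed
  let ?J = "monophonic_interval (complementary_prism G) (Inl w) (Inl u)"
  note cov = monophonic_intervalI[OF P, of _ "Inl w" "Inl u"]
  have cover: "Inl x \<in> ?J \<and> Inr x \<in> ?J" if x: "x \<in> pverts G" for x
  proof -
    consider "x \<in> ?C" | "x = w" | "x \<noteq> w" "(x, w) \<in> parcs G" | "x \<notin> ?C" "x \<noteq> w" "(x, w) \<notin> parcs G"
      by blast
    then show ?thesis
    proof cases
      \<comment> \<open>The path crosses to the complement at \<open>w\<close>, returns at
        \<open>x\<close>, and continues to \<open>u\<close> inside the component. There it avoids
        all neighbours of \<open>w\<close>, so no chord arises.\<close>
      case 1
      then obtain p where p: "induced_path G p" "hd p = x" "last p = u" "set p \<subseteq> A w"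
        using induced_path_rtrancl[OF G(1) uA[OF w], of x] by (auto simp: R_def A_def)
      obtain p' where p': "p = x # p'" using p by (cases p) auto
      let ?p = "[Inl w, Inr w] @ Inr x # map Inl p"
      have "distinct p" using p G(1) induced_path_distinct by blast
      have "induced_path (complementary_prism G) (map Inl p)"
        using p(1) by (rule induced_path_map) auto
      then have "induced_path (complementary_prism G) ?p"
        using p(4) wV x \<open>distinct p\<close> sym unfolding p' by (auto simp: A_def)
      moreover have "last ?p = Inl u" using p p' by (simp add: last_map split: if_splits)
      ultimately show ?thesis using cov[of ?p] p p' by auto
    next
      case 2
      have "induced_path (complementary_prism G) [Inl w, Inr w, Inr u, Inl u]"
        using wV w0(1) by auto
      from cov[OF this] show ?thesis using 2 by simp
    next
      case 3
      then have "(x, u) \<notin> parcs G" "x \<noteq> u" using w sym wV by (auto simp: far_def)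
      then have "induced_path (complementary_prism G) [Inl w, Inl x, Inr x, Inr u, Inl u]"
        using 3 wV x w0(1) sym by auto
      from cov[OF this] show ?thesis by simp
    next
      \<comment> \<open>Here \<open>s\<close> links \<open>w\<close> to \<open>x\<close> by
        \<open>far_complete\<close>; it is not adjacent to \<open>u\<close> because \<open>u\<close>
        and \<open>w\<close> have no common neighbour.\<close>
      case 4
      have "x \<noteq> u" "(x, u) \<notin> parcs G"
        using R_step[OF uC _ _ w, of x] 4 uC x sym by (auto simp: A_def)
      then have "induced_path (complementary_prism G) [Inl w, Inl s, Inl x, Inr x, Inr u, Inl u]"
        using 4 wV x w0(1) sym sw su far_complete[OF x] by auto
      from cov[OF this] show ?thesis by simp
    qed
  qed
  show ?thesis
    by (intro bexI[of _ w] conjI monophonic_set_pairI P) (use w0 wV cover in \<open>auto simp: pverts_complementary_prism\<close>)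
qed

section \<open>Diameter two\<close>

definition diam_le_two :: "'a pair_pre_digraph \<Rightarrow> bool" where
  "diam_le_two G \<longleftrightarrow> (\<forall>x\<in>pverts G. \<forall>y\<in>pverts G. x \<noteq> y \<and> (x, y) \<notin> parcs G \<longrightarrow>
    (\<exists>t. (x, t) \<in> parcs G \<and> (t, y) \<in> parcs G))"

text \<open>This is the obstruction to \<open>monophonic_set_near\<close>: a nonneighbour
  \<open>x\<close> of \<open>u\<close> that can be reached from \<open>u\<close> in two steps only
  through \<open>w\<close>.\<close>

definition sole_link :: "'a pair_pre_digraph \<Rightarrow> 'a \<Rightarrow> 'a \<Rightarrow> 'a \<Rightarrow> bool" where
  "sole_link G u w x \<longleftrightarrow> (w, x) \<in> parcs G \<and> x \<noteq> u \<and> (u, x) \<notin> parcs G \<and>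
    (\<forall>t. (u, t) \<in> parcs G \<and> (t, x) \<in> parcs G \<longrightarrow> t = w)"

text \<open>Each vertex is placed on an explicit path that starts at \<open>u\<close> in
  \<open>G\<close> and ends at the copy of \<open>w\<close>. Diameter two supplies a common
  neighbour in \<open>G\<close> or in the complement wherever a direct step is impossible.\<close>

lemma monophonic_set_near:
  assumes G: "pair_graph G" and uw: "(u, w) \<in> parcs G"
    and diam: "diam_le_two G" "diam_le_two (complement_graph G)"
    and sole: "\<nexists>x. sole_link G u w x"
  shows "monophonic_set (complementary_prism G) {Inl u, Inr w}"
proof -
  have P: "pair_graph (complementary_prism G)" using G by (rule pair_graph_complementary_prism)
  have sym: "(x, y) \<in> parcs G \<longleftrightarrow> (y, x) \<in> parcs G" for x y using pair_graph_arcs_sym[OF G] by blast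
  note vert = pair_graph_arcs_verts[OF G]
  have nbr: "\<exists>t. (x, t) \<in> parcs G \<and> (t, y) \<in> parcs G"
    if "x \<in> pverts G" "y \<in> pverts G" "x \<noteq> y" "(x, y) \<notin> parcs G" for x y
    using that diam(1) by (auto simp: diam_le_two_def)
  have conbr: "\<exists>q\<in>pverts G. q \<noteq> x \<and> q \<noteq> y \<and> (x, q) \<notin> parcs G \<and> (q, y) \<notin> parcs G"
    if "(x, y) \<in> parcs G" for x y
    using that diam(2) vert[OF that] by (fastforce simp: diam_le_two_def)
  have two: "\<exists>t. t \<noteq> w \<and> (u, t) \<in> parcs G \<and> (t, x) \<in> parcs G"
    if "(w, x) \<in> parcs G" "x \<noteq> u" "(u, x) \<notin> parcs G" for x
    using that sole by (auto simp: sole_link_def)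
  have uwV: "u \<in> pverts G" "w \<in> pverts G" "u \<noteq> w" "(w, u) \<in> parcs G" using vert[OF uw] uw sym by auto
  let ?J = "monophonic_interval (complementary_prism G) (Inl u) (Inr w)"
  note cov = monophonic_intervalI[OF P, of _ "Inl u" "Inr w"]
  have "Inl x \<in> ?J \<and> Inr x \<in> ?J" if x: "x \<in> pverts G" for x
  proof -
    obtain q where q: "q \<in> pverts G" "q \<noteq> u" "q \<noteq> w" "(u, q) \<notin> parcs G" "(q, w) \<notin> parcs G"
      using conbr[OF uw] by blast
    consider "x = u" | "x = w" | "x \<noteq> u" "x \<noteq> w" "(u, x) \<in> parcs G" "(x, w) \<notin> parcs G"
      | "x \<noteq> u" "x \<noteq> w" "(u, x) \<notin> parcs G" "(x, w) \<notin> parcs G"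
      | "x \<noteq> u" "x \<noteq> w" "(u, x) \<notin> parcs G" "(x, w) \<in> parcs G"
      | "x \<noteq> u" "x \<noteq> w" "(u, x) \<in> parcs G" "(x, w) \<in> parcs G" by blast
    then show ?thesis
    proof cases
      case 1
      have "induced_path (complementary_prism G) [Inl u, Inr u, Inr q, Inr w]"
        using q uw uwV by auto
      from cov[OF this] show ?thesis using 1 by simp
    next
      case 2
      have "induced_path (complementary_prism G) [Inl u, Inl w, Inr w]"
        using uw uwV by auto
      from cov[OF this] show ?thesis using 2 by simp
    next
      case 3
      have "induced_path (complementary_prism G) [Inl u, Inl x, Inr x, Inr w]"
        using 3 x uw uwV by auto
      from cov[OF this] show ?thesis by simp
    next
      case 4
      obtain t where t: "(u, t) \<in> parcs G" "(t, x) \<in> parcs G" using nbr[of u x] 4 x uwV by auto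
      have "induced_path (complementary_prism G) [Inl u, Inr u, Inr x, Inr w]"
        using 4 x uw uwV by auto
      moreover have "induced_path (complementary_prism G) [Inl u, Inl t, Inl x, Inr x, Inr w]"
        using 4 x t uw uwV vert by (auto simp: sym)
      ultimately show ?thesis using cov by fastforce
    next
      \<comment> \<open>The path must reach \<open>x\<close> without using \<open>w\<close>, whose
        copy is the far end. The absence of a sole link supplies such a \<open>t\<close>.\<close>
      case 5
      obtain t where t: "t \<noteq> w" "(u, t) \<in> parcs G" "(t, x) \<in> parcs G" using two[of x] 5 x sym by auto
      obtain r where r: "r \<in> pverts G" "r \<noteq> x" "r \<noteq> w" "(x, r) \<notin> parcs G" "(r, w) \<notin> parcs G"
        using conbr[of x w] 5 by blast
      have "induced_path (complementary_prism G) [Inl u, Inl t, Inl x, Inr x, Inr r, Inr w]"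
        using 5 x t r uw uwV vert by (auto simp: sym)
      from cov[OF this] show ?thesis by simp
    next
      case 6
      obtain r where r: "r \<in> pverts G" "r \<noteq> x" "r \<noteq> w" "(x, r) \<notin> parcs G" "(r, w) \<notin> parcs G"
        using conbr[of x w] 6 by blast
      have "induced_path (complementary_prism G) [Inl u, Inl x, Inr x, Inr r, Inr w]"
        using 6 x r uw uwV vert by (auto simp: sym)
      from cov[OF this] show ?thesis by simp
    qed
  qed
  then show ?thesis using uwV by (intro monophonic_set_pairI P) (auto simp: pverts_complementary_prism)
qed

section \<open>Neighbourhoods, and degrees when every arc has a sole link\<close>

definition nbrs :: "'a pair_pre_digraph \<Rightarrow> 'a \<Rightarrow> 'a set" where
  "nbrs H x = {y. (x, y) \<in> parcs H}"

lemma in_nbrs_iff [simp]: "y \<in> nbrs H x \<longleftrightarrow> (x, y) \<in> parcs H"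
  by (simp add: nbrs_def)

lemma nbrs_subset: "pair_graph H \<Longrightarrow> nbrs H x \<subseteq> pverts H"
  by (auto dest: pair_graph_arcs_verts(2))

lemma finite_nbrs: "pair_graph H \<Longrightarrow> finite (nbrs H x)"
  using finite_pverts nbrs_subset by (metis finite_subset)

text \<open>A chosen \<open>f w\<close> determines \<open>w\<close> as its only common neighbour
  with \<open>u\<close>, which makes the choice injective.\<close>

lemma sole_link_inj:
  assumes G: "pair_graph G" and sole: "\<forall>w\<in>nbrs G u. \<exists>x. sole_link G u w x"
  obtains f where "inj_on f (nbrs G u)" "f ` nbrs G u \<subseteq> nbrs (complement_graph G) u"
    "\<And>w. w \<in> nbrs G u \<Longrightarrow> sole_link G u w (f w)"
proof -
  obtain f where f: "\<And>w. w \<in> nbrs G u \<Longrightarrow> sole_link G u w (f w)"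
    using sole by metis
  have "inj_on f (nbrs G u)"
  proof (rule inj_onI)
    fix w w' assume "w \<in> nbrs G u" "w' \<in> nbrs G u" "f w = f w'"
    then show "w = w'" using f[of w] f[of w'] by (auto simp: sole_link_def)
  qed
  moreover have "f ` nbrs G u \<subseteq> nbrs (complement_graph G) u"
    using f pair_graph_arcs_verts[OF G] by (fastforce simp: sole_link_def)
  ultimately show thesis using f that by blast
qed

context
  fixes G :: "'a pair_pre_digraph"
  assumes G: "pair_graph G"
    and sole: "\<And>u w. (u, w) \<in> parcs G \<Longrightarrow> \<exists>x. sole_link G u w x"
    and cosole: "\<And>u w. (u, w) \<in> parcs (complement_graph G) \<Longrightarrow> \<exists>x. sole_link (complement_graph G) u w x"
begin

text \<open>The injections given by \<open>sole_link_inj\<close> for \<open>G\<close> and for its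
  complement go in opposite directions.\<close>

lemma card_nbrs_complement: "card (nbrs (complement_graph G) u) = card (nbrs G u)"
proof (rule antisym)
  have C: "pair_graph (complement_graph G)" using G by (rule pair_graph_complement_graph)
  show "card (nbrs G u) \<le> card (nbrs (complement_graph G) u)"
    using sole_link_inj[OF G] sole finite_nbrs[OF C] by (metis card_inj_on_le in_nbrs_iff)
  show "card (nbrs (complement_graph G) u) \<le> card (nbrs G u)"
    using sole_link_inj[OF C] cosole finite_nbrs[OF G] complement_complement_graph[OF G]
    by (metis card_inj_on_le in_nbrs_iff)
qed

lemma sole_link_bij:
  obtains f where "bij_betw f (nbrs G u) (nbrs (complement_graph G) u)"
    "\<And>w. w \<in> nbrs G u \<Longrightarrow> sole_link G u w (f w)"
proof -
  obtain f where f: "inj_on f (nbrs G u)" "f ` nbrs G u \<subseteq> nbrs (complement_graph G) u"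
    "\<And>w. w \<in> nbrs G u \<Longrightarrow> sole_link G u w (f w)"
    using sole_link_inj[OF G] sole by (metis in_nbrs_iff)
  have "f ` nbrs G u = nbrs (complement_graph G) u"
    using f card_nbrs_complement finite_nbrs[OF pair_graph_complement_graph[OF G]]
    by (intro card_subset_eq) (simp_all add: card_image)
  then show thesis using that f by (simp add: bij_betw_def)
qed

end

text \<open>Write \<open>w = g q\<close>. A nonneighbour \<open>y\<close> of \<open>u\<close>
  adjacent to \<open>w\<close> has the form \<open>f v\<close>, and \<open>v\<close> is its only
  neighbour among those of \<open>u\<close>, so \<open>y = f w\<close>. If \<open>y\<close> is not
  adjacent to \<open>w\<close>, then the sole link in the complement forces \<open>y = q\<close>.
  Hence \<open>u\<close> has exactly the two nonneighbours \<open>f w\<close> and \<open>q\<close>,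
  and equally many neighbours.\<close>

lemma card_nbrs_eq_2:
  assumes sole: "\<And>u w. (u, w) \<in> parcs G \<Longrightarrow> \<exists>x. sole_link G u w x"
    and cosole: "\<And>u w. (u, w) \<in> parcs (complement_graph G) \<Longrightarrow> \<exists>x. sole_link (complement_graph G) u w x"
    and G: "pair_graph G" and uw: "(u, w) \<in> parcs G"
  shows "card (nbrs G u) = 2"
proof -
  let ?C = "complement_graph G"
  have C: "pair_graph ?C" using G by (rule pair_graph_complement_graph)
  have CC: "complement_graph ?C = G" using G by (rule complement_complement_graph)
  obtain f where f: "bij_betw f (nbrs G u) (nbrs ?C u)" "\<And>w. w \<in> nbrs G u \<Longrightarrow> sole_link G u w (f w)"
    using sole_link_bij[OF G sole cosole] by blast
  obtain g where g: "bij_betw g (nbrs ?C u) (nbrs G u)" "\<And>q. q \<in> nbrs ?C u \<Longrightarrow> sole_link ?C u q (g q)"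
    using sole_link_bij[OF C cosole, of u] sole unfolding CC by metis
  have "w \<in> g ` nbrs ?C u" using g(1) uw by (simp add: bij_betw_def)
  then obtain q where q: "q \<in> nbrs ?C u" "g q = w" by blast
  have fw: "f w \<in> nbrs ?C u" by (rule bij_betw_apply[OF f(1)]) (simp add: uw)
  have "y \<in> {f w, q}" if y: "y \<in> nbrs ?C u" for y
  proof (cases "(y, w) \<in> parcs G")
    case True
    have "y \<in> f ` nbrs G u" using y f(1) by (simp only: bij_betw_def)
    then obtain v where v: "v \<in> nbrs G u" "f v = y" by blast
    then have "w = v" using True f(2)[of v] uw pair_graph_arcs_sym[OF G] by (auto simp: sole_link_def)
    then show ?thesis using v by simp
  next
    case False
    then have "(y, w) \<in> parcs ?C" using y uw pair_graph_arcs_verts[OF G] by auto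
    then show ?thesis using g(2)[OF q(1)] q y by (auto simp: sole_link_def)
  qed
  then have "nbrs ?C u = {f w, q}" using q(1) fw by blast
  moreover have "f w \<noteq> q"
  proof -
    have "(w, f w) \<in> parcs G" using f(2)[of w] uw by (simp add: sole_link_def)
    moreover have "(q, w) \<notin> parcs G" using g(2)[OF q(1)] q(2) by (simp add: sole_link_def)
    ultimately show ?thesis using pair_graph_arcs_sym[OF G] by blast
  qed
  ultimately show ?thesis using card_nbrs_complement[OF G sole cosole, of u] by simp
qed

section \<open>The five-cycle\<close>

text \<open>Arcs are pairs of vertices, so the arc map of an isomorphism is determined by its vertex
  map.\<close>

lemma digraph_iso_with_proj_iff:
  assumes G: "pair_graph G" and H: "pair_graph H"
  shows "digraph_iso (with_proj G) (with_proj H) \<longleftrightarrow>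
    (\<exists>f. bij_betw f (pverts G) (pverts H) \<and>
      (\<forall>x\<in>pverts G. \<forall>y\<in>pverts G. (x, y) \<in> parcs G \<longleftrightarrow> (f x, f y) \<in> parcs H))"
    (is "?L \<longleftrightarrow> ?R")
proof
  assume ?L
  then obtain h where h: "pre_digraph.digraph_isomorphism (with_proj G) h" "with_proj H = app_iso h (with_proj G)"
    by (auto simp: digraph_iso_def)
  let ?f = "iso_verts h"
  have inj: "inj_on ?f (pverts G)" and vH: "pverts H = ?f ` pverts G"
    using h by (auto simp: pre_digraph.digraph_isomorphism_def app_iso_def with_proj_def)
  have aH: "parcs H = iso_arcs h ` parcs G" and [simp]: "iso_tail h = fst" "iso_head h = snd"
    using h(2) by (auto simp: app_iso_def with_proj_def)
  have arc: "iso_arcs h (x, y) = (?f x, ?f y)" if "(x, y) \<in> parcs G" for x y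
    using h(1) that by (force simp: pre_digraph.digraph_isomorphism_def prod_eq_iff)
  have "(x, y) \<in> parcs G \<longleftrightarrow> (?f x, ?f y) \<in> parcs H" if xy: "x \<in> pverts G" "y \<in> pverts G" for x y
  proof
    assume "(x, y) \<in> parcs G" then show "(?f x, ?f y) \<in> parcs H" using aH arc by force
  next
    assume "(?f x, ?f y) \<in> parcs H"
    then obtain a b where ab: "(a, b) \<in> parcs G" "(?f x, ?f y) = (?f a, ?f b)"
      using aH arc by auto
    then show "(x, y) \<in> parcs G"
      using inj xy pair_graph_arcs_verts[OF G ab(1)] by (auto dest: inj_onD)
  qed
  then show ?R using inj vH by (auto simp: bij_betw_def)
next
  assume ?R
  then obtain f where f: "bij_betw f (pverts G) (pverts H)"
    and arc: "\<And>x y. x \<in> pverts G \<Longrightarrow> y \<in> pverts G \<Longrightarrow> (x, y) \<in> parcs G \<longleftrightarrow> (f x, f y) \<in> parcs H" by blast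
  interpret pair_graph G by fact
  let ?h = "\<lparr> iso_verts = f, iso_arcs = map_prod f f, iso_head = snd, iso_tail = fst \<rparr>"
  have inj: "inj_on f (pverts G)" and img: "f ` pverts G = pverts H" using f by (auto simp: bij_betw_def)
  have "inj_on (map_prod f f) (parcs G)"
    using inj pair_graph_arcs_verts[OF G] by (auto simp: inj_on_def)
  then have "digraph_isomorphism ?h"
    using inj wf_digraph_axioms by (auto simp: digraph_isomorphism_def)
  moreover have "parcs H = map_prod f f ` parcs G"
  proof (intro subset_antisym subrelI)
    fix a b assume ab: "(a, b) \<in> parcs H"
    then obtain x y where "x \<in> pverts G" "y \<in> pverts G" "a = f x" "b = f y"
      using pair_graph_arcs_verts[OF H ab] img by blast
    then show "(a, b) \<in> map_prod f f ` parcs G" using ab arc by force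
  next
    fix a b assume "(a, b) \<in> map_prod f f ` parcs G"
    then obtain x y where xy: "(x, y) \<in> parcs G" "a = f x" "b = f y" by auto
    then show "(a, b) \<in> parcs H" using arc pair_graph_arcs_verts(1,2)[OF G xy(1)] by simp
  qed
  then have "with_proj H = app_iso ?h (with_proj G)"
    using img by (simp add: app_iso_def with_proj_def)
  ultimately show ?L unfolding digraph_iso_def by blast
qed

lemma lessThan_5: "{..<5} = {0, 1, 2, 3, 4::nat}" by auto

lemma digraph_iso_cycle_graph_5_iff:
  assumes G: "pair_graph G"
  shows "digraph_iso (with_proj G) (with_proj (cycle_graph 5)) \<longleftrightarrow>
    (\<exists>a b c d e. distinct [a, b, c, d, e] \<and> pverts G = {a, b, c, d, e} \<and>
      parcs G = {(a, b), (b, c), (c, d), (d, e), (e, a), (b, a), (c, b), (d, c), (e, d), (a, e)})"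
    (is "?L \<longleftrightarrow> ?R")
proof
  let ?C = "cycle_graph 5"
  have C: "pverts ?C = {0, 1, 2, 3, 4}"
    "parcs ?C = {(0, 1), (1, 2), (2, 3), (3, 4), (4, 0), (1, 0), (2, 1), (3, 2), (4, 3), (0, 4)}"
  proof -
    show "pverts ?C = {0, 1, 2, 3, 4}" by (simp add: cycle_graph_def lessThan_5)
    have "parcs ?C = (\<lambda>i. (i, Suc i mod 5)) ` {..<5} \<union> (\<lambda>i. (Suc i mod 5, i)) ` {..<5}"
      by (auto simp: cycle_graph_def)
    also have "\<dots> = {(0, 1), (1, 2), (2, 3), (3, 4), (4, 0), (1, 0), (2, 1), (3, 2), (4, 3), (0, 4)}"
      unfolding lessThan_5 by (simp add: insert_commute numeral_2_eq_2)
    finally show "parcs ?C = {(0, 1), (1, 2), (2, 3), (3, 4), (4, 0), (1, 0), (2, 1), (3, 2), (4, 3), (0, 4)}" .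
  qed
  have C5: "pair_graph ?C" by (rule pair_graph_cycle_graph) simp
  note iff = digraph_iso_with_proj_iff[OF G C5]
  show ?R if L: ?L
  proof -
    obtain f where f: "bij_betw f (pverts G) (pverts ?C)"
      and arc: "\<And>x y. x \<in> pverts G \<Longrightarrow> y \<in> pverts G \<Longrightarrow> (x, y) \<in> parcs G \<longleftrightarrow> (f x, f y) \<in> parcs ?C"
      using L unfolding iff by blast
    \<comment> \<open>The inverse isomorphism names the vertices of \<open>G\<close> in cyclic
      order.\<close>
    define g where "g = the_inv_into (pverts G) f"
    have g: "bij_betw g (pverts ?C) (pverts G)" "\<And>i. i \<in> pverts ?C \<Longrightarrow> f (g i) = i"
      "\<And>x. x \<in> pverts G \<Longrightarrow> g (f x) = x"
      unfolding g_def using f bij_betw_the_inv_into[OF f] f_the_inv_into_f_bij_betw[OF f]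
      by (auto simp: the_inv_into_f_f bij_betw_imp_inj_on)
    have V: "pverts G = {g 0, g 1, g 2, g 3, g 4}" using g(1) C by (auto simp: bij_betw_def)
    have D: "distinct [g 0, g 1, g 2, g 3, g 4]" using g(1) C by (auto simp: bij_betw_def inj_on_def)
    have fg: "f (g 0) = 0" "f (g 1) = 1" "f (g 2) = 2" "f (g 3) = 3" "f (g 4) = 4"
      using g(2) C(1) by auto
    have "parcs G = map_prod g g ` parcs ?C"
    proof (intro subset_antisym subrelI)
      fix x y assume xy: "(x, y) \<in> parcs G"
      then have "x \<in> pverts G" "y \<in> pverts G" using pair_graph_arcs_verts[OF G] by auto
      then show "(x, y) \<in> map_prod g g ` parcs ?C" using xy arc g(3) by (metis map_prod_imageI)
    next
      fix x y assume "(x, y) \<in> map_prod g g ` parcs ?C"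
      then obtain i j where ij: "(i, j) \<in> parcs ?C" "x = g i" "y = g j" by auto
      then have "i \<in> pverts ?C" "j \<in> pverts ?C"
        using pair_graph_arcs_verts[OF C5] by blast+
      then show "(x, y) \<in> parcs G" using ij arc[of "g i" "g j"] g(2) bij_betw_apply[OF g(1)] by simp
    qed
    then show ?R using V D C(2) by (intro exI[of _ "g 0"] exI[of _ "g 1"] exI[of _ "g 2"]
      exI[of _ "g 3"] exI[of _ "g 4"]) simp
  qed
  show ?L if R: ?R
  proof -
    obtain a b c d e where D: "distinct [a, b, c, d, e]" and V: "pverts G = {a, b, c, d, e}"
      and E: "parcs G = {(a, b), (b, c), (c, d), (d, e), (e, a), (b, a), (c, b), (d, c), (e, d), (a, e)}"
      using R by blast
    have D': "distinct [e, d, c, b, a]" using D by auto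
    define f :: "'a \<Rightarrow> nat" where
      "f x = (if x = a then 0 else if x = b then 1 else if x = c then 2 else if x = d then 3 else 4)" for x
    have f: "f a = 0" "f b = 1" "f c = 2" "f d = 3" "f e = 4" using D by (auto simp: f_def)
    have "bij_betw f (pverts G) (pverts ?C)" unfolding bij_betw_def V C by (auto simp: f inj_on_def)
    moreover have "\<forall>x\<in>pverts G. \<forall>y\<in>pverts G. (x, y) \<in> parcs G \<longleftrightarrow> (f x, f y) \<in> parcs ?C"
      unfolding V C E using D D' by (simp add: f)
    ultimately show ?L unfolding iff by blast
  qed
qed

text \<open>Around \<open>a\<close> there are two neighbours \<open>w\<close>, \<open>w'\<close> and
  two nonneighbours \<open>x\<close>, \<open>x'\<close>, matched by sole links. Degree two then
  closes the cycle \<open>a\<close>, \<open>w\<close>, \<open>x\<close>, \<open>x'\<close>,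
  \<open>w'\<close>.\<close>

lemma digraph_iso_cycle_graph_5I:
  assumes G: "pair_graph G" and ab: "a \<in> pverts G" "b \<in> pverts G" "a \<noteq> b"
    and sole: "\<And>u w. (u, w) \<in> parcs G \<Longrightarrow> \<exists>x. sole_link G u w x"
    and cosole: "\<And>u w. (u, w) \<in> parcs (complement_graph G) \<Longrightarrow> \<exists>x. sole_link (complement_graph G) u w x"
  shows "digraph_iso (with_proj G) (with_proj (cycle_graph 5))"
proof -
  note sym = pair_graph_arcs_sym[OF G] and vert = pair_graph_arcs_verts[OF G]
  let ?C = "complement_graph G"
  have C: "pair_graph ?C" using G by (rule pair_graph_complement_graph)
  note card_eq = card_nbrs_complement[OF G sole cosole]
  \<comment> \<open>Otherwise \<open>a\<close> would be isolated in the complement too, by the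
    equality of degrees, although \<open>b\<close> is adjacent to it in one of the two
    graphs.\<close>
  have "nbrs G a \<noteq> {}"
  proof
    assume *: "nbrs G a = {}"
    then have "nbrs ?C a = {}" using card_eq[of a] finite_nbrs[OF C] by simp
    then have "(a, b) \<notin> parcs G" "(a, b) \<notin> parcs ?C"
      using * unfolding nbrs_def by blast+
    then show False using ab by simp
  qed
  then have deg: "card (nbrs G a) = 2" using card_nbrs_eq_2[OF sole cosole G] by auto
  then obtain w w' where N: "nbrs G a = {w, w'}" "w \<noteq> w'" by (auto simp: card_2_iff)
  obtain f where f: "bij_betw f (nbrs G a) (nbrs ?C a)" "\<And>w. w \<in> nbrs G a \<Longrightarrow> sole_link G a w (f w)"
    using sole_link_bij[OF G sole cosole] by blast
  define x x' where "x = f w" and "x' = f w'"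
  have M: "nbrs ?C a = {x, x'}" "x \<noteq> x'"
    using f(1) N by (auto simp: bij_betw_def x_def x'_def inj_on_def)
  have V: "pverts G = {a, w, x, x', w'}"
  proof -
    have "pverts G = insert a (nbrs G a \<union> nbrs ?C a)" using ab(1) vert by auto
    then show ?thesis unfolding N M by auto
  qed
  have aN: "(a, y) \<in> parcs G \<longleftrightarrow> y = w \<or> y = w'" for y
    unfolding in_nbrs_iff[symmetric] N by simp
  have aM: "(a, y) \<in> parcs ?C \<longleftrightarrow> y = x \<or> y = x'" for y
    unfolding in_nbrs_iff[symmetric] M by simp
  have D: "distinct [a, w, x, x', w']"
    using aN aM[of x] aM[of x'] vert(3)[of a] N(2) M(2) by auto
  have s: "sole_link G a w x" "sole_link G a w' x'" using f(2) N by (auto simp: x_def x'_def)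
  have wx: "(w, x) \<in> parcs G" "(w', x) \<notin> parcs G" "(w', x') \<in> parcs G" "(w, x') \<notin> parcs G"
    using s N(2) aN[of w] aN[of w'] unfolding sole_link_def by blast+
  have "nbrs G w = {a, x}"
  proof -
    have "card (nbrs G w) = 2" using card_nbrs_eq_2[OF sole cosole G wx(1)] .
    moreover have "{a, x} \<subseteq> nbrs G w" "card {a, x} = 2" using wx(1) aN sym[of a w] D by auto
    ultimately show ?thesis using card_subset_eq[OF finite_nbrs[OF G], of "{a, x}" w] by simp
  qed
  then have ww': "(w, w') \<notin> parcs G" using D unfolding in_nbrs_iff[symmetric] by auto
  have "nbrs G x = {w, x'}"
  proof -
    have "card (nbrs G x) = 2" using card_nbrs_eq_2[OF sole cosole G sym[OF wx(1)]] .
    moreover have "nbrs G x \<subseteq> {w, x'}"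
    proof
      fix y assume y: "y \<in> nbrs G x"
      then have "y \<in> pverts G" "y \<noteq> x" "(y, x) \<in> parcs G" using vert[of x y] sym[of x y] by auto
      moreover have "y \<noteq> a" "y \<noteq> w'" using calculation(3) aN[of x] D wx(2) by auto
      ultimately show "y \<in> {w, x'}" using V by auto
    qed
    moreover have "card {w, x'} = 2" using D by simp
    ultimately show ?thesis by (intro card_subset_eq) auto
  qed
  then have xx': "(x, x') \<in> parcs G" unfolding in_nbrs_iff[symmetric] by simp
  have "parcs G = {(a, w), (w, x), (x, x'), (x', w'), (w', a), (w, a), (x, w), (x', x), (w', x'), (a, w')}"
    (is "_ = ?E")
  proof (intro subset_antisym subrelI)
    fix y z assume yz: "(y, z) \<in> parcs G"
    then have "y \<in> {a, w, x, x', w'}" "z \<in> {a, w, x, x', w'}" "y \<noteq> z" using vert[OF yz] V by auto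
    then show "(y, z) \<in> ?E" using yz sym[OF yz] aN wx ww' sym[of w' x] sym[of x' w] D by auto
  qed (use aN wx xx' sym in auto)
  then show ?thesis unfolding digraph_iso_cycle_graph_5_iff[OF G] using V D by blast
qed

section \<open>The Petersen graph\<close>

text \<open>These properties characterise the Petersen graph, which is the complementary prism of \<open>C\<^sub>5\<close>.\<close>

locale petersen = pair_graph H for H :: "'a pair_pre_digraph" +
  assumes card_pverts: "card (pverts H) = 10"
    and card_nbrs: "x \<in> pverts H \<Longrightarrow> card (nbrs H x) = 3"
    and nbrs_disjoint: "(x, y) \<in> parcs H \<Longrightarrow> nbrs H x \<inter> nbrs H y = {}"
    and nbrs_meet: "\<lbrakk>x \<in> pverts H; y \<in> pverts H; x \<noteq> y; (x, y) \<notin> parcs H\<rbrakk>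
      \<Longrightarrow> \<exists>z. nbrs H x \<inter> nbrs H y = {z}"
begin

lemma sym: "(x, y) \<in> parcs H \<Longrightarrow> (y, x) \<in> parcs H"
  by (rule pair_graph_arcs_sym[OF pair_graph])

lemma vert: "(x, y) \<in> parcs H \<Longrightarrow> x \<in> pverts H" "(x, y) \<in> parcs H \<Longrightarrow> y \<in> pverts H"
    "(x, y) \<in> parcs H \<Longrightarrow> x \<noteq> y"
  by (rule pair_graph_arcs_verts[OF pair_graph]; assumption)+

lemma no_triangle: "(x, y) \<in> parcs H \<Longrightarrow> (y, z) \<in> parcs H \<Longrightarrow> (x, z) \<notin> parcs H"
  using nbrs_disjoint[of x y] by auto

text \<open>This excludes four-cycles; together with \<open>no_triangle\<close> it says that the
  girth is at least five.\<close>

lemma common_nbr_unique: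
  assumes "x \<noteq> y" "(x, z) \<in> parcs H" "(y, z) \<in> parcs H" "(x, z') \<in> parcs H" "(y, z') \<in> parcs H"
  shows "z = z'"
proof -
  have "(x, y) \<notin> parcs H" using no_triangle[OF assms(2) sym[OF assms(3)]] .
  then obtain t where t: "nbrs H x \<inter> nbrs H y = {t}"
    using nbrs_meet[OF vert(1)[OF assms(2)] vert(1)[OF assms(3)] assms(1)] by blast
  have "z \<in> nbrs H x \<inter> nbrs H y" "z' \<in> nbrs H x \<inter> nbrs H y" using assms by simp_all
  then show ?thesis unfolding t by simp
qed

lemma common_nbr:
  assumes "x \<in> pverts H" "y \<in> pverts H" "x \<noteq> y" "(x, y) \<notin> parcs H"
  obtains z where "(x, z) \<in> parcs H" "(z, y) \<in> parcs H"
proof -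
  obtain z where "nbrs H x \<inter> nbrs H y = {z}" using nbrs_meet assms by blast
  then have "z \<in> nbrs H x \<inter> nbrs H y" by simp
  then show thesis using that[of z] sym[of y z] by simp
qed

lemma third_nbr:
  assumes "x \<in> pverts H"
  obtains z where "(x, z) \<in> parcs H" "z \<noteq> a" "z \<noteq> b"
proof -
  have "\<not> nbrs H x \<subseteq> {a, b}"
  proof
    assume "nbrs H x \<subseteq> {a, b}"
    then have "card (nbrs H x) \<le> card {a, b}" by (intro card_mono) auto
    also have "\<dots> \<le> 2" by (simp add: card_insert_if)
    finally show False using card_nbrs[OF assms] by simp
  qed
  then obtain z where "z \<in> nbrs H x" "z \<notin> {a, b}" by blast
  then show thesis using that by simp
qed

lemma monophonic_set_nbrs:
  assumes c: "c \<in> pverts H"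
  shows "monophonic_set H (nbrs H c)"
proof -
  have "x \<in> monophonic_closure H (nbrs H c)" if x: "x \<in> pverts H" for x
  proof -
    consider "(c, x) \<in> parcs H" | "x = c" | "x \<noteq> c" "(x, c) \<notin> parcs H" using sym by blast
    then obtain u w p where "u \<in> nbrs H c" "w \<in> nbrs H c" "induced_path H p" "hd p = u" "last p = w" "x \<in> set p"
    proof cases
      case 1
      then show thesis using that[of x x "[x]"] x by auto
    next
      case 2
      obtain u where u: "(c, u) \<in> parcs H" using third_nbr[OF c] by blast
      obtain w where w: "(c, w) \<in> parcs H" "w \<noteq> u" using third_nbr[OF c] by blast
      show thesis
        using that[of u w "[u, c, w]"] 2 u w sym[OF u] no_triangle[OF u, of w] no_triangle[OF sym[OF u] w(1)] vert
        by auto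
    next
      \<comment> \<open>Such an \<open>x\<close> has distance two from \<open>c\<close>. A second
        neighbour \<open>w\<close> of \<open>c\<close> is not adjacent to \<open>x\<close>, since
        there are no four-cycles, so \<open>u\<close>, \<open>x\<close>, \<open>b\<close>,
        \<open>w\<close> is induced.\<close>
      case 3
      obtain u where u: "(x, u) \<in> parcs H" "(u, c) \<in> parcs H" using common_nbr[OF x c] 3 by blast
      obtain w where w: "(c, w) \<in> parcs H" "w \<noteq> u" using third_nbr[OF c] by blast
      have xw: "(x, w) \<notin> parcs H" "x \<noteq> w"
        using common_nbr_unique[of x c u w] 3 u w sym by blast+
      obtain b where b: "(x, b) \<in> parcs H" "(b, w) \<in> parcs H"
        using common_nbr[OF x _ _ xw(1)] xw vert w by blast
      have "(u, w) \<notin> parcs H" "(u, b) \<notin> parcs H"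
        using no_triangle u w b sym by blast+
      moreover have "u \<noteq> b" using calculation b by auto
      ultimately have "induced_path H [u, x, b, w]"
        using u w xw b vert sym by auto
      then show thesis using that[of u w "[u, x, b, w]"] u w sym by auto
    qed
    then show ?thesis using monophonic_intervalI[OF pair_graph]
      by (fastforce simp: monophonic_closure_def)
  qed
  then show ?thesis using monophonic_interval_subset[OF pair_graph] nbrs_subset[OF pair_graph]
    by (auto simp: monophonic_set_def monophonic_closure_def)
qed

lemma third_nbr_not_on_induced_path:
  assumes p: "induced_path H p" and uw: "hd p \<noteq> last p" "(c, hd p) \<in> parcs H" "(c, last p) \<in> parcs H"
    and d: "(c, d) \<in> parcs H" "d \<noteq> hd p" "d \<noteq> last p"
  shows "d \<notin> set p"
proof
  assume "d \<in> set p"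
  have dist: "distinct p" using p induced_path_distinct pair_graph by blast
  define n where "n = length p"
  have chordless: "j = Suc i \<or> i = Suc j" if "i < n" "j < n" "(p ! i, p ! j) \<in> parcs H" for i j
    using p that by (auto simp: induced_path_iff[OF pair_graph] n_def)
  have ne: "p \<noteq> []" using p by auto
  then have n0: "0 < n" and hd: "hd p = p ! 0" and last: "last p = p ! (n - 1)"
    by (simp_all add: hd_conv_nth last_conv_nth n_def)
  obtain m where m: "m < n" "d = p ! m" using \<open>d \<in> set p\<close> by (auto simp: in_set_conv_nth n_def)
  \<comment> \<open>If \<open>c\<close> were on the path, it would be adjacent to both ends along
    it, leaving three vertices and no place for \<open>d\<close>.\<close>
  have cp: "c \<notin> set p"
  proof
    assume "c \<in> set p"
    then obtain k where k: "k < n" "c = p ! k" by (auto simp: in_set_conv_nth n_def)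
    have "k = 1" using chordless[of k 0] k uw(2) hd n0 by auto
    moreover have "n - 1 = Suc k \<or> k = n" using chordless[of k "n - 1"] k uw(3) last n0 by auto
    ultimately have "n = 3" using k by auto
    moreover have "m \<noteq> 0" "m \<noteq> n - 1" "m \<noteq> k"
      using m(2) d(2,3) hd last k(2) vert(3)[OF d(1)] by metis+
    ultimately show False using m \<open>k = 1\<close> by auto
  qed
  have arc: "(p ! i, p ! Suc i) \<in> parcs H" if "Suc i < n" for i
    using induced_path_arc[OF p] that by (simp add: n_def)
  have du: "(d, hd p) \<notin> parcs H" "(d, last p) \<notin> parcs H" using no_triangle uw d sym by blast+
  \<comment> \<open>Position 1 would give a triangle through \<open>c\<close>, and position 2 a
    second common neighbour of \<open>hd p\<close> and \<open>d\<close>. The same argument from the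
    other end gives \<open>n7\<close>, so the path has at least seven vertices.\<close>
  have m3: "3 \<le> m"
  proof (rule ccontr)
    assume "\<not> 3 \<le> m"
    moreover have "m \<noteq> 0" using m(2) d(2) hd by metis
    moreover have "m \<noteq> 1" using arc[of 0] m du sym hd by auto
    moreover have "m \<noteq> 2"
    proof
      assume "m = 2"
      then have "(hd p, p ! 1) \<in> parcs H" "(d, p ! 1) \<in> parcs H" "p ! 1 \<in> set p"
        using arc[of 0] sym[OF arc[of 1]] m hd by (auto simp: n_def numeral_2_eq_2)
      then show False using common_nbr_unique[of "hd p" d c "p ! 1"] d uw sym cp by blast
    qed
    ultimately show False by linarith
  qed
  have n7: "m + 3 < n"
  proof (rule ccontr)
    assume "\<not> m + 3 < n"
    moreover have "m + 1 \<noteq> n" using m d last by auto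
    moreover have "m + 2 \<noteq> n" using arc[of m] m du last by auto
    moreover have "m + 3 \<noteq> n"
    proof
      assume "m + 3 = n"
      then have "n - 1 = Suc (Suc m)" by simp
      with \<open>m + 3 = n\<close> have "(last p, p ! Suc m) \<in> parcs H" "(d, p ! Suc m) \<in> parcs H" "p ! Suc m \<in> set p"
        using sym[OF arc[of "Suc m"]] arc[of m] m last by (auto simp: n_def)
      then show False using common_nbr_unique[of "last p" d c "p ! Suc m"] d uw sym cp by blast
    qed
    ultimately show False using m by linarith
  qed
  have n: "7 \<le> n" using m3 n7 by linarith
  have a01: "(p ! 0, p ! 1) \<in> parcs H" and a12: "(p ! 1, p ! 2) \<in> parcs H"
    using arc[of 0] arc[of 1] n by (simp_all add: numeral_2_eq_2)
  have c0: "(c, p ! 0) \<in> parcs H" using uw hd by simp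
  have inp: "p ! i \<in> set p" if "i < n" for i using that by (simp add: n_def)
  \<comment> \<open>The neighbours \<open>t0\<close>, \<open>t1\<close>, \<open>t2\<close> of the
    first three vertices lie off the path by chordlessness. Girth five makes them and
    \<open>c\<close> four distinct vertices, so there would be at least eleven in all.\<close>
  obtain t0 where t0: "(p ! 0, t0) \<in> parcs H" "t0 \<noteq> p ! 1" "t0 \<noteq> c"
    using third_nbr vert(1)[OF a01] by blast
  obtain t1 where t1: "(p ! 1, t1) \<in> parcs H" "t1 \<noteq> p ! 0" "t1 \<noteq> p ! 2"
    using third_nbr vert(1)[OF a12] by blast
  obtain t2 where t2: "(p ! 2, t2) \<in> parcs H" "t2 \<noteq> p ! 1" "t2 \<noteq> p ! 3"
    using third_nbr vert(2)[OF a12] by blast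
  have "t0 \<notin> set p"
    using chordless[of 0] t0 n by (force simp: in_set_conv_nth n_def)
  moreover have "t1 \<notin> set p"
    using chordless[of 1] t1 n by (force simp: in_set_conv_nth n_def numeral_2_eq_2)
  moreover have "t2 \<notin> set p"
    using chordless[of 2] t2 n by (force simp: in_set_conv_nth n_def numeral_2_eq_2 numeral_3_eq_3)
  moreover have "p ! 0 \<noteq> p ! 2" using nth_eq_iff_index_eq[OF dist, of 0 2] n unfolding n_def by linarith
  then have "t2 \<noteq> c" "t0 \<noteq> t2"
    using common_nbr_unique[of "p ! 0" "p ! 2" "p ! 1"] a01 a12 c0 t0 t2 sym inp[of 1] n cp
    by blast+
  moreover have "t1 \<noteq> c" "t0 \<noteq> t1" "t1 \<noteq> t2"
    using no_triangle a01 a12 c0 t0 t1 t2 sym by blast+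
  ultimately have "card ({c, t0, t1, t2} \<union> set p) = 4 + n"
    using cp t0 dist by (simp add: distinct_card n_def)
  moreover have "{c, t0, t1, t2} \<union> set p \<subseteq> pverts H"
    using t0 t1 t2 c0 vert induced_path_subset[OF p pair_graph] by blast
  then have "card ({c, t0, t1, t2} \<union> set p) \<le> 10"
    using card_mono[OF pair_finite_verts] card_pverts by metis
  ultimately show False using n by simp
qed

lemma monophonic_set_card_neq_2:
  assumes S: "monophonic_set H S"
  shows "card S \<noteq> 2"
proof
  assume "card S = 2"
  then obtain u w where S2: "S = {u, w}" "u \<noteq> w" by (auto simp: card_2_iff)
  then have uw: "u \<in> pverts H" "w \<in> pverts H" using S by (auto simp: monophonic_set_def)
  have cover: "\<exists>p. induced_path H p \<and> {hd p, last p} = {u, w} \<and> x \<in> set p"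
    if "x \<in> pverts H" "x \<noteq> u" "x \<noteq> w" for x
  proof -
    have "x \<in> monophonic_closure H {u, w}" using S S2 that by (simp add: monophonic_set_def)
    then have "x \<in> monophonic_interval H u w \<union> monophonic_interval H w u"
      using that monophonic_interval_self[OF pair_graph] by (auto simp: monophonic_closure_def)
    then show ?thesis by (auto elim!: monophonic_intervalE[OF pair_graph])
  qed
  show False
  proof (cases "(u, w) \<in> parcs H")
    case True
    obtain x where x: "(u, x) \<in> parcs H" "x \<noteq> w" using third_nbr[OF uw(1)] by blast
    then obtain p where p: "induced_path H p" "{hd p, last p} = {u, w}" "x \<in> set p"
      using cover[of x] vert by blast
    \<comment> \<open>An induced path with adjacent ends consists of those ends only, so it misses
      \<open>x\<close>.\<close>
    have "(hd p, last p) \<in> parcs H" using p(2) True sym S2(2) by (auto simp: doubleton_eq_iff)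
    with p(1) have "set p = {hd p, last p}"
      by (induction H p rule: induced_path.induct) (auto split: if_splits)
    then show False using p(2,3) x vert(3)[of u u] by auto
  next
    case False
    obtain c where c: "(u, c) \<in> parcs H" "(c, w) \<in> parcs H" using common_nbr[OF uw S2(2) False] .
    obtain d where d: "(c, d) \<in> parcs H" "d \<noteq> u" "d \<noteq> w" using third_nbr vert(2)[OF c(1)] by blast
    then obtain p where p: "induced_path H p" "{hd p, last p} = {u, w}" "d \<in> set p"
      using cover[of d] vert by blast
    then show False
      using third_nbr_not_on_induced_path[OF p(1), of c d] S2(2) c d sym by (auto simp: doubleton_eq_iff)
  qed
qed

lemma monophonic_number_eq_3: "monophonic_number H = 3"
proof -
  obtain c where c: "c \<in> pverts H" using card_pverts by fastforce
  obtain d where d: "(c, d) \<in> parcs H" using third_nbr[OF c] by blast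
  show ?thesis
  proof (rule monophonic_number_eqI)
    show "monophonic_set H (nbrs H c)" using c by (rule monophonic_set_nbrs)
    show "card (nbrs H c) = 3" using c by (rule card_nbrs)
    show "3 \<le> card S" if "monophonic_set H S" for S
      using two_le_card_monophonic_set[OF pair_graph vert[OF d] that] monophonic_set_card_neq_2[OF that]
      by simp
  qed
qed

end

lemma petersen_complementary_prism:
  assumes G: "pair_graph G" and D: "distinct [a, b, c, d, e]" and V: "pverts G = {a, b, c, d, e}"
    and E: "parcs G = {(a, b), (b, c), (c, d), (d, e), (e, a), (b, a), (c, b), (d, c), (e, d), (a, e)}"
  shows "petersen (complementary_prism G)"
proof -
  let ?P = "complementary_prism G"
  have P: "pair_graph ?P" using G by (rule pair_graph_complementary_prism)
  have VP: "pverts ?P = {Inl a, Inl b, Inl c, Inl d, Inl e, Inr a, Inr b, Inr c, Inr d, Inr e}"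
    by (auto simp: pverts_complementary_prism V)
  have D': "distinct [e, d, c, b, a]" using D by auto
  \<comment> \<open>Each neighbourhood becomes a filter of the explicit list of ten vertices, so
    that the table \<open>N\<close> can be computed.\<close>
  have nbrs: "nbrs ?P x = {y \<in> pverts ?P. (x, y) \<in> parcs ?P}" for x
    using nbrs_subset[OF P] by (auto simp: nbrs_def)
  have N: "nbrs ?P (Inl a) = {Inl b, Inl e, Inr a}" "nbrs ?P (Inl b) = {Inl a, Inl c, Inr b}"
    "nbrs ?P (Inl c) = {Inl b, Inl d, Inr c}" "nbrs ?P (Inl d) = {Inl c, Inl e, Inr d}"
    "nbrs ?P (Inl e) = {Inl d, Inl a, Inr e}"
    "nbrs ?P (Inr a) = {Inr c, Inr d, Inl a}" "nbrs ?P (Inr b) = {Inr d, Inr e, Inl b}"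
    "nbrs ?P (Inr c) = {Inr e, Inr a, Inl c}" "nbrs ?P (Inr d) = {Inr a, Inr b, Inl d}"
    "nbrs ?P (Inr e) = {Inr b, Inr c, Inl e}"
    unfolding nbrs VP using D D' by (auto simp: V E)
  have arc: "(x, y) \<in> parcs ?P \<longleftrightarrow> y \<in> nbrs ?P x" for x y by simp
  have disj: "\<forall>x\<in>pverts ?P. \<forall>y\<in>nbrs ?P x. nbrs ?P x \<inter> nbrs ?P y = {}"
    unfolding VP using D D' by (simp add: N del: in_nbrs_iff)
  have meet: "\<forall>x\<in>pverts ?P. \<forall>y\<in>pverts ?P. x \<noteq> y \<and> y \<notin> nbrs ?P x \<longrightarrow>
      (\<exists>z. nbrs ?P x \<inter> nbrs ?P y = {z})"
    unfolding VP using D D' by (simp add: N del: in_nbrs_iff)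
  have "\<forall>x\<in>pverts ?P. card (nbrs ?P x) = 3"
    unfolding VP using D D' by (simp add: N del: in_nbrs_iff)
  moreover have "card (pverts ?P) = 10" unfolding VP using D by simp
  ultimately show ?thesis
    using P disj meet pair_graph_arcs_verts[OF P]
    unfolding petersen_def petersen_axioms_def arc by blast
qed

section \<open>Combination of the cases: five-cycle, large diameter, diameter two, single
  vertex\<close>

theorem theorem4p6:
  fixes G :: "'a pair_pre_digraph"
  assumes "pair_graph G"
    and "Digraph_Component.connected (with_proj G)"
    and "Digraph_Component.connected (with_proj (complement_graph G))"
  shows "monophonic_number (complementary_prism G) =
    (if digraph_iso (with_proj G) (with_proj (cycle_graph 5)) then 3 else 2)"
proof (cases "digraph_iso (with_proj G) (with_proj (cycle_graph 5))")
  case True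
  then obtain a b c d e where "distinct [a, b, c, d, e]" "pverts G = {a, b, c, d, e}"
    "parcs G = {(a, b), (b, c), (c, d), (d, e), (e, a), (b, a), (c, b), (d, c), (e, d), (a, e)}"
    using digraph_iso_cycle_graph_5_iff[OF assms(1)] by blast
  then have "petersen (complementary_prism G)"
    using petersen_complementary_prism[OF assms(1)] by blast
  then show ?thesis using True petersen.monophonic_number_eq_3 by simp
next
  case False
  let ?P = "complementary_prism G" and ?C = "complement_graph G"
  have P: "pair_graph ?P" using assms(1) by (rule pair_graph_complementary_prism)
  have C: "pair_graph ?C" using assms(1) by (rule pair_graph_complement_graph)
  note CC = complement_complement_graph[OF assms(1)]
  have far: "\<exists>S. monophonic_set (complementary_prism H) S \<and> card S = 2"
    if H: "pair_graph H" "Digraph_Component.connected (with_proj H)" and diam: "\<not> diam_le_two H"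
    for H :: "'a pair_pre_digraph"
  proof -
    obtain u w where "u \<in> pverts H" "w \<in> pverts H" "u \<noteq> w" "(u, w) \<notin> parcs H"
      "\<And>t. (u, t) \<in> parcs H \<Longrightarrow> (t, w) \<notin> parcs H"
      using diam by (auto simp: diam_le_two_def)
    from monophonic_set_far[OF H this] obtain w
      where "w \<noteq> u" "monophonic_set (complementary_prism H) {Inl w, Inl u}" by blast
    then show ?thesis by (intro exI[of _ "{Inl w, Inl u}"]) simp
  qed
  have near: "\<exists>S. monophonic_set (complementary_prism H) S \<and> card S = 2"
    if "pair_graph H" "diam_le_two H" "diam_le_two (complement_graph H)"
      "(u, w) \<in> parcs H" "\<nexists>x. sole_link H u w x"
    for H :: "'a pair_pre_digraph" and u w
    using monophonic_set_near[OF that(1,4,2,3,5)] by (intro exI[of _ "{Inl u, Inr w}"]) simp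
  obtain v where v: "v \<in> pverts G" using assms(2) by (auto simp: connected_conv)
  have "\<exists>S. monophonic_set ?P S \<and> card S = 2"
  proof (cases "\<exists>a\<in>pverts G. a \<noteq> v")
    case True
    then obtain a where a: "a \<in> pverts G" "v \<noteq> a" by blast
    show ?thesis
    proof (cases "diam_le_two G \<and> diam_le_two ?C")
      case True
      then have diam: "diam_le_two G" "diam_le_two ?C" "diam_le_two (complement_graph ?C)"
        unfolding CC by simp_all
      \<comment> \<open>As \<open>G\<close> is not the five-cycle, an arc without a sole link exists
        in \<open>G\<close> or in its complement.\<close>
      consider u w where "(u, w) \<in> parcs G" "\<nexists>x. sole_link G u w x"
        | u w where "(u, w) \<in> parcs ?C" "\<nexists>x. sole_link ?C u w x"
        using False digraph_iso_cycle_graph_5I[OF assms(1) v a] by blast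
      then show ?thesis
      proof cases
        case 1
        then show ?thesis using near[OF assms(1) diam(1,2)] by simp
      next
        case 2
        then show ?thesis using near[OF C diam(2,3)] ex_monophonic_pair_swap[OF assms(1)] by simp
      qed
    next
      case False
      then show ?thesis
        using far[OF assms(1,2)] far[OF C assms(3)] ex_monophonic_pair_swap[OF assms(1)] by blast
    qed
  next
    \<comment> \<open>For the one-vertex graph the prism is a single edge, generated by its two
      ends.\<close>
    case False
    have "induced_path ?P [Inl v, Inr v]" using v by simp
    note J = monophonic_intervalI[OF P this refl refl]
    have "pverts ?P = {Inl v, Inr v}"
    proof -
      have "pverts G = {v}" using v False by blast
      then show ?thesis by (auto simp: pverts_complementary_prism)
    qed
    then have "monophonic_set ?P {Inl v, Inr v}"
      using J by (intro monophonic_set_pairI P) auto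
    then show ?thesis by (intro exI[of _ "{Inl v, Inr v}"]) simp
  qed
  then obtain S where "monophonic_set ?P S" "card S = 2" by blast
  then have "monophonic_number ?P = 2"
    using two_le_card_monophonic_set[OF P, of "Inl v" "Inr v"] v by (intro monophonic_number_eqI) auto
  then show ?thesis using False by simp
qed

end
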